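(* Let $f_1,f_2,f_3,f_4\in\mathbb R$ be arbitrary. Then the adaptive dynamics of the alternating memory-1 game with payoff vector $(f_1,f_2,f_3,f_4)$, i.e. the system $\dot p_i=\left.\frac{\partial A(\mathbf p,\mathbf q)}{\partial p_i}\right|_{\mathbf q=\mathbf p}$, $i=1,\ldots,4$, has the following two invariant quantities (functions constant along all solutions): $$F_1=(p_1-1)^2+p_3^2,\qquad F_2=(p_2-1)^2+p_4^2.$$
   Context: Write $\mathbf p=(p_1,p_2,p_3,p_4)=(p_{CC},p_{CD},p_{DC},p_{DD})$ and similarly $\mathbf q$. The transition matrix of the alternating memory-1 game is $$\mathbf M_1(\mathbf p,\mathbf q)=\begin{pmatrix} p_1q_1&p_1(1-q_1)&(1-p_1)q_2&(1-p_1)(1-q_2)\\ p_2q_3&p_2(1-q_3)&(1-p_2)q_4&(1-p_2)(1-q_4)\\ p_3q_1&p_3(1-q_1)&(1-p_3)q_2&(1-p_3)(1-q_2)\\ p_4q_3&p_4(1-q_3)&(1-p_4)q_4&(1-p_4)(1-q_4)\end{pmatrix}.$$ The payoff function is $A(\mathbf p,\mathbf q)=\det\mathbf M^1/\det\mathbf M^2$, where $\mathbf M^1$ is $\mathbf M_1(\mathbf p,\mathbf q)-I$ with its last column replaced by $(f_1,f_2,f_3,f_4)^T$ and $\mathbf M^2$ is $\mathbf M_1(\mathbf p,\mathbf q)-I$ with its last column replaced by $(1,1,1,1)^T$. (For $\mathbf p,\mathbf q\in(0,1)^4$ this equals $\langle\nu,(f_1,f_2,f_3,f_4)\rangle$ with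 $\nu$ the unique probability vector satisfying $\nu^T\mathbf M_1=\nu^T$.) The system is considered on the set of $\mathbf p\in\mathbb R^4$ where $\det\mathbf M^2\neq0$ at $\mathbf q=\mathbf p$; this set contains $(0,1)^4$. *)

theory Defs
  imports "HOL-Analysis.Analysis"
begin

text \<open>The states CC, CD, DC, DD are the indices 1, 2, 3, 4 (in the index type \<^typ>\<open>4\<close> the
  numeral 4 coincides with 0; the four indices are nevertheless distinct).\<close>

definition transition_matrix :: "real^4 \<Rightarrow> real^4 \<Rightarrow> real^4^4" where
  "transition_matrix p q = vector [
     vector [p$1 * q$1, p$1 * (1 - q$1), (1 - p$1) * q$2, (1 - p$1) * (1 - q$2)],
     vector [p$2 * q$3, p$2 * (1 - q$3), (1 - p$2) * q$4, (1 - p$2) * (1 - q$4)],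
     vector [p$3 * q$1, p$3 * (1 - q$1), (1 - p$3) * q$2, (1 - p$3) * (1 - q$2)],
     vector [p$4 * q$3, p$4 * (1 - q$3), (1 - p$4) * q$4, (1 - p$4) * (1 - q$4)]]"

definition replace_last_column :: "real^4^4 \<Rightarrow> real^4 \<Rightarrow> real^4^4" where
  "replace_last_column M v = (\<chi> i j. if j = 4 then v$i else M$i$j)"

definition numerator_matrix :: "real^4 \<Rightarrow> real^4 \<Rightarrow> real^4 \<Rightarrow> real^4^4" where
  "numerator_matrix f p q = replace_last_column (transition_matrix p q - mat 1) f"

definition denominator_matrix :: "real^4 \<Rightarrow> real^4 \<Rightarrow> real^4^4" where
  "denominator_matrix p q = replace_last_column (transition_matrix p q - mat 1) (vec 1)"

definition payoff :: "real^4 \<Rightarrow> real^4 \<Rightarrow> real^4 \<Rightarrow> real" where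
  "payoff f p q = det (numerator_matrix f p q) / det (denominator_matrix p q)"

definition partial_deriv :: "(real^4 \<Rightarrow> real) \<Rightarrow> 4 \<Rightarrow> real^4 \<Rightarrow> real" where
  "partial_deriv g i p = deriv (\<lambda>x. g (\<chi> j. if j = i then x else p$j)) (p$i)"

text \<open>The opponent's strategy is held fixed at \<open>q = p\<close> while the first argument
  of the payoff is differentiated.\<close>

definition adaptive_dynamics :: "real^4 \<Rightarrow> real^4 \<Rightarrow> real^4" where
  "adaptive_dynamics f p = (\<chi> i. partial_deriv (\<lambda>p'. payoff f p' p) i p)"

definition adaptive_domain :: "(real^4) set" where
  "adaptive_domain = {p. det (denominator_matrix p p) \<noteq> 0}"

text \<open>Time intervals may be open, closed or half-open, bounded or unbounded; at an endpoint
  belonging to the interval the derivative is one-sided.\<close>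

definition is_solution ::
  "('a::real_normed_vector) set \<Rightarrow> ('a \<Rightarrow> 'a) \<Rightarrow> real set \<Rightarrow> (real \<Rightarrow> 'a) \<Rightarrow> bool" where
  "is_solution D X T x \<longleftrightarrow> is_interval T \<and>
     (\<forall>t\<in>T. x t \<in> D \<and> (x has_vector_derivative X (x t)) (at t within T))"

definition invariant_quantity ::
  "('a::real_normed_vector) set \<Rightarrow> ('a \<Rightarrow> 'a) \<Rightarrow> ('a \<Rightarrow> real) \<Rightarrow> bool" where
  "invariant_quantity D X F \<longleftrightarrow>
     (\<forall>T x. is_solution D X T x \<longrightarrow> (\<forall>s\<in>T. \<forall>t\<in>T. F (x s) = F (x t)))"

end

(* Write N_f for the determinant in the numerator of the payoff; the denominator is N_f with
   f = (1,1,1,1). N_f is affine in each coordinate of p, so its partial derivatives are differences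
   of determinants. At q = p, N_f factors as G(p) s_f(p), where s_f(p) is linear in f and G does not
   depend on f, and (p1 - 1) d/dp1 + p3 d/dp3 turns N_f into L(p) s_f(p), again with L independent
   of f. The derivative of the quotient in this direction therefore vanishes, which says that the
   vector field is tangent to the level sets of F1. F2 is treated in the same way. *)
theory Submission
  imports Defs
begin

lemma vector_4 [simp]:
  "(vector [w,x,y,z] :: ('a::zero)^4)$1 = w"
  "(vector [w,x,y,z] :: ('a::zero)^4)$2 = x"
  "(vector [w,x,y,z] :: ('a::zero)^4)$3 = y"
  "(vector [w,x,y,z] :: ('a::zero)^4)$4 = z"
  unfolding vector_def by simp_all

text \<open>Splitting the permutations in the Leibniz sum one index at a time gives an explicit
  polynomial, which lets \<open>algebra\<close> settle the determinant identities below.\<close>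

lemma det_4:
  "det (A :: 'a::comm_ring_1^4^4) =
     A$1$1 * (A$2$2 * A$3$3 * A$4$4 + A$2$3 * A$3$4 * A$4$2 + A$2$4 * A$3$2 * A$4$3
            - A$2$2 * A$3$4 * A$4$3 - A$2$3 * A$3$2 * A$4$4 - A$2$4 * A$3$3 * A$4$2)
   - A$1$2 * (A$2$1 * A$3$3 * A$4$4 + A$2$3 * A$3$4 * A$4$1 + A$2$4 * A$3$1 * A$4$3
            - A$2$1 * A$3$4 * A$4$3 - A$2$3 * A$3$1 * A$4$4 - A$2$4 * A$3$3 * A$4$1)
   + A$1$3 * (A$2$1 * A$3$2 * A$4$4 + A$2$2 * A$3$4 * A$4$1 + A$2$4 * A$3$1 * A$4$2
            - A$2$1 * A$3$4 * A$4$2 - A$2$2 * A$3$1 * A$4$4 - A$2$4 * A$3$2 * A$4$1)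
   - A$1$4 * (A$2$1 * A$3$2 * A$4$3 + A$2$2 * A$3$3 * A$4$1 + A$2$3 * A$3$1 * A$4$2
            - A$2$1 * A$3$3 * A$4$2 - A$2$2 * A$3$1 * A$4$3 - A$2$3 * A$3$2 * A$4$1)"
proof -
  have f: "finite {2::4, 3, 4}" "1 \<notin> {2::4, 3, 4}" "finite {3::4, 4}" "2 \<notin> {3::4, 4}" "finite {4::4}" "3 \<notin> {4::4}"
    by auto
  show ?thesis
    unfolding det_def UNIV_4
    unfolding sum_over_permutations_insert[OF f(1,2)]
    unfolding sum_over_permutations_insert[OF f(3,4)]
    unfolding sum_over_permutations_insert[OF f(5,6)]
    unfolding permutes_sing
    by (simp add: sign_swap_id permutation_swap_id sign_compose sign_id swap_id_eq permutation_compose algebra_simps transpose_def)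
qed

abbreviation replace_coord :: "real^4 \<Rightarrow> 4 \<Rightarrow> real \<Rightarrow> real^4" where
  "replace_coord p i x \<equiv> (\<chi> j. if j = i then x else p$j)"

lemma denominator_matrix_eq: "denominator_matrix p q = numerator_matrix (vec 1) p q"
  by (simp add: denominator_matrix_def numerator_matrix_def)

text \<open>For a function affine in coordinate i, the value at 1 minus the value at 0 is the
  partial derivative; the opponent stays at p throughout.\<close>

definition numerator_slope :: "real^4 \<Rightarrow> 4 \<Rightarrow> real^4 \<Rightarrow> real" where
  "numerator_slope f i p = det (numerator_matrix f (replace_coord p i 1) p)
     - det (numerator_matrix f (replace_coord p i 0) p)"

lemmas numerator_matrix_entries =
  det_4 numerator_matrix_def replace_last_column_def transition_matrix_def mat_def

text \<open>Coordinate i of the first strategy enters only row i of the transition matrix, and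
  affinely.\<close>

lemma numerator_matrix_row_affine:
  "numerator_matrix f (replace_coord p i x) q $ k =
    (if k = i then numerator_matrix f (replace_coord p i 0) q $ k
       + x *s (numerator_matrix f (replace_coord p i 1) q $ k
               - numerator_matrix f (replace_coord p i 0) q $ k)
     else numerator_matrix f (replace_coord p i 0) q $ k)"
  using exhaust_4[of k]
  by (auto simp: vec_eq_iff forall_4 numerator_matrix_def replace_last_column_def
      transition_matrix_def mat_def algebra_simps)

lemma det_numerator_matrix_affine:
  "det (numerator_matrix f (replace_coord p i x) p)
     = det (numerator_matrix f (replace_coord p i 0) p) + x * numerator_slope f i p"
proof -
  let ?M = "\<lambda>x. numerator_matrix f (replace_coord p i x) p"
  have "det (?M x) = det (?M 0) + x * det (\<chi> k. if k = i then ?M 1 $ k - ?M 0 $ k else ?M 0 $ k)"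
    for x
  proof -
    have "?M x = (\<chi> k. if k = i then ?M 0 $ k + x *s (?M 1 $ k - ?M 0 $ k) else ?M 0 $ k)"
      by (subst vec_eq_iff) (simp add: numerator_matrix_row_affine[where x = x])
    moreover have "(\<chi> k. if k = i then ?M 0 $ k else ?M 0 $ k) = ?M 0"
      by (simp add: vec_eq_iff)
    ultimately show ?thesis
      by (simp add: det_row_add det_row_mul)
  qed
  \<comment> \<open>The instance at 1 identifies the coefficient of x as the slope.\<close>
  from this[of x] this[of 1] show ?thesis
    by (simp add: numerator_slope_def)
qed

lemma partial_deriv_payoff:
  assumes "p \<in> adaptive_domain"
  shows "partial_deriv (\<lambda>p'. payoff f p' p) i p =
    (numerator_slope f i p * det (numerator_matrix (vec 1) p p)
     - det (numerator_matrix f p p) * numerator_slope (vec 1) i p)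
    / (det (numerator_matrix (vec 1) p p))\<^sup>2"
proof -
  have p: "replace_coord p i (p$i) = p"
    by (simp add: vec_eq_iff)
  have D: "((\<lambda>x. det (numerator_matrix g (replace_coord p i x) p))
      has_field_derivative numerator_slope g i p) (at (p$i))" for g
  proof -
    have linear: "((\<lambda>x. c + x * m) has_field_derivative m) (at y)" for c m y :: real
      by (auto intro!: derivative_eq_intros)
    have "(\<lambda>x. det (numerator_matrix g (replace_coord p i x) p))
        = (\<lambda>x. det (numerator_matrix g (replace_coord p i 0) p) + x * numerator_slope g i p)"
      by (rule ext, rule det_numerator_matrix_affine)
    then show ?thesis
      by (rule ssubst) (rule linear)
  qed
  have nz: "det (numerator_matrix (vec 1) p p) \<noteq> 0"
    using assms by (simp add: adaptive_domain_def denominator_matrix_eq)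
  show ?thesis
    unfolding partial_deriv_def payoff_def denominator_matrix_eq
    by (rule DERIV_imp_deriv)
      (use DERIV_divide[OF D D, of "vec 1" f] nz in \<open>simp add: p power2_eq_square\<close>)
qed

text \<open>At \<open>q = p\<close> the transition matrix is the square of the chain in which a player with strategy
  \<open>p\<close> moves and the two roles are then exchanged. The weights below are its unnormalised
  stationary distribution.\<close>

definition half_round_payoff :: "real^4 \<Rightarrow> real^4 \<Rightarrow> real" where
  "half_round_payoff f p =
     f$1 * p$3 * p$4 + (f$2 + f$3) * (1 - p$1) * p$4 + f$4 * (1 - p$1) * (1 - p$2)"

text \<open>The rows of the transition matrix minus the identity sum to 0, so its last-column
  cofactors form a left null vector, proportional to the stationary weights. Expanding along the
  payoff column explains the factorisation.\<close>

lemma det_numerator_matrix_diag: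
  "det (numerator_matrix f p p) =
     (p$3 * p$4 - 2 * p$2 * p$3 + p$1 * p$2 + p$2 - p$1 - 1) * half_round_payoff f p"
  by (simp add: numerator_matrix_entries half_round_payoff_def) algebra

text \<open>The direction (p1 - 1, p3) is half the gradient of F1 in coordinates 1 and 3.\<close>

lemma numerator_slope_13:
  "(p$1 - 1) * numerator_slope f 1 p + p$3 * numerator_slope f 3 p =
     (p$3 * p$4 - 2 * p$2 * p$3 + p$1 * p$2 - p$1) * half_round_payoff f p"
  unfolding numerator_slope_def
  by (simp add: numerator_matrix_entries half_round_payoff_def) algebra

lemma numerator_slope_24:
  "(p$2 - 1) * numerator_slope f 2 p + p$4 * numerator_slope f 4 p =
     (p$3 * p$4 - 2 * p$2 * p$3 + p$1 * p$2 + p$2 + p$3 - p$1 - 1) * half_round_payoff f p"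
  unfolding numerator_slope_def
  by (simp add: numerator_matrix_entries half_round_payoff_def) algebra

lemma adaptive_dynamics_orthogonal:
  assumes "p \<in> adaptive_domain"
    and "\<And>g. a * numerator_slope g i p + b * numerator_slope g k p = c * half_round_payoff g p"
  shows "a * adaptive_dynamics f p $ i + b * adaptive_dynamics f p $ k = 0"
proof -
  let ?N = "\<lambda>g. det (numerator_matrix g p p)"
  let ?s = "\<lambda>g. a * numerator_slope g i p + b * numerator_slope g k p"
  have "a * adaptive_dynamics f p $ i + b * adaptive_dynamics f p $ k
      = (?s f * ?N (vec 1) - ?N f * ?s (vec 1)) / (?N (vec 1))\<^sup>2"
    by (simp add: adaptive_dynamics_def partial_deriv_payoff[OF assms(1)] diff_divide_distrib
        add_divide_distrib algebra_simps)
  \<comment> \<open>With g = f and g = \<open>vec 1\<close>, both products have the same four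
    factors: c, the f-free factor of the determinant, and the two values of
    \<open>half_round_payoff\<close>.\<close>
  also have "?s f * ?N (vec 1) - ?N f * ?s (vec 1) = 0"
    unfolding assms(2) det_numerator_matrix_diag by simp
  finally show ?thesis by simp
qed

text \<open>The assumed expression is half the derivative of the quantity along a solution; a zero
  derivative on an interval forces constancy.\<close>

lemma invariant_quantity_circle:
  fixes X :: "real^4 \<Rightarrow> real^4"
  assumes "\<And>p. p \<in> D \<Longrightarrow> (p$i - 1) * X p $ i + p$k * X p $ k = 0"
  shows "invariant_quantity D X (\<lambda>p. (p$i - 1)\<^sup>2 + (p$k)\<^sup>2)"
  unfolding invariant_quantity_def
proof (intro allI impI ballI)
  fix T x s t
  assume sol: "is_solution D X T x" and st: "s \<in> T" "t \<in> T"
  let ?F = "\<lambda>t. (x t $ i - 1)\<^sup>2 + (x t $ k)\<^sup>2"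
  have deriv0: "(?F has_derivative (\<lambda>h. 0)) (at u within T)" if u: "u \<in> T" for u
  proof -
    have D: "x u \<in> D" and x: "(x has_vector_derivative X (x u)) (at u within T)"
      using sol u by (auto simp: is_solution_def)
    have c: "((\<lambda>t. x t $ j) has_real_derivative X (x u) $ j) (at u within T)" for j
      using bounded_linear.has_vector_derivative[OF bounded_linear_vec_nth x]
      by (simp add: has_real_derivative_iff_has_vector_derivative)
    have "(?F has_real_derivative
        2 * ((x u $ i - 1) * X (x u) $ i + x u $ k * X (x u) $ k)) (at u within T)"
      by (auto intro!: derivative_eq_intros c simp: algebra_simps)
    then show ?thesis
      by (simp add: assms[OF D] has_field_derivative_def lambda_zero)
  qed
  have "convex T"
    using sol by (simp add: is_solution_def is_interval_convex)
  from has_derivative_zero_unique[OF this deriv0 st] show "?F s = ?F t" .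
qed

theorem theorem3p3:
  fixes f :: "real^4"
  shows "invariant_quantity adaptive_domain (adaptive_dynamics f)
           (\<lambda>p. (p$1 - 1)\<^sup>2 + (p$3)\<^sup>2)
       \<and> invariant_quantity adaptive_domain (adaptive_dynamics f)
           (\<lambda>p. (p$2 - 1)\<^sup>2 + (p$4)\<^sup>2)"
proof
  show "invariant_quantity adaptive_domain (adaptive_dynamics f)
          (\<lambda>p. (p$1 - 1)\<^sup>2 + (p$3)\<^sup>2)"
    by (rule invariant_quantity_circle, rule adaptive_dynamics_orthogonal)
      (assumption, rule numerator_slope_13)
  show "invariant_quantity adaptive_domain (adaptive_dynamics f)
          (\<lambda>p. (p$2 - 1)\<^sup>2 + (p$4)\<^sup>2)"
    by (rule invariant_quantity_circle, rule adaptive_dynamics_orthogonal)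
      (assumption, rule numerator_slope_24)
qed

end
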